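(* Let $a,b$ be nonnegative integers with $a+b\ge 1$, and let $\mu$ be a positive real number with $a\ge\mu b$. Consider all $\binom{a+b}{a}$ sequences consisting of $a$ votes for candidate $A$ and $b$ votes for candidate $B$, each equally likely. For a sequence and $1\le r\le a+b$, let $a_r$ and $b_r$ be the numbers of votes for $A$ and $B$ among its first $r$ votes. Call a sequence cute if $a_r\ge \mu b_r$ for all $1\le r\le a+b$. Let $P^*$ be the probability that a uniformly random such sequence is cute. Then $$\frac{\lfloor a-\mu b+1\rfloor}{a+b}\;\le\; P^*\;\le\;\frac{a+1-\mu b}{a+1}.$$
   Context: $\lfloor x\rfloor$ denotes the greatest integer not exceeding $x$. Note $a_r+b_r=r$.
   Formalization: The lower bound is asserted only for b ≥ 1: when b = 0 the single sequence is cute, so P* = 1, while the stated lower bound would be (a+1)/a > 1; the upper bound is proved in full. *)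

theory Defs
  imports "HOL-Probability.Probability"
begin

datatype vote = VoteA | VoteB

definition ballots :: "nat \<Rightarrow> nat \<Rightarrow> vote list set" where
  "ballots a b = {xs. count_list xs VoteA = a \<and> count_list xs VoteB = b}"

definition cute :: "real \<Rightarrow> vote list \<Rightarrow> bool" where
  "cute \<mu> xs \<longleftrightarrow> (\<forall>r\<in>{1..length xs}.
     real (count_list (take r xs) VoteA) \<ge> \<mu> * real (count_list (take r xs) VoteB))"

definition cute_prob :: "real \<Rightarrow> nat \<Rightarrow> nat \<Rightarrow> real" where
  "cute_prob \<mu> a b = measure_pmf.prob (pmf_of_set (ballots a b)) {xs. cute \<mu> xs}"

lemma length_ballots:
  assumes "xs \<in> ballots a b"
  shows "length xs = a + b"
proof -
  have "length ys = count_list ys VoteA + count_list ys VoteB" for ys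
  proof (induction ys)
    case (Cons y ys)
    then show ?case by (cases y) auto
  qed simp
  with assms show ?thesis by (simp add: ballots_def)
qed

text \<open>The function \<^const>\<open>pmf_of_set\<close> is meaningful only for finite nonempty sets, which
  the next two facts establish.\<close>

lemma finite_ballots: "finite (ballots a b)"
proof (rule finite_subset)
  have "x \<in> {VoteA, VoteB}" for x
    by (cases x) simp_all
  then have "set xs \<subseteq> {VoteA, VoteB}" for xs
    by blast
  then show "ballots a b \<subseteq> {xs. set xs \<subseteq> {VoteA, VoteB} \<and> length xs = a + b}"
    using length_ballots by blast
  show "finite {xs. set xs \<subseteq> {VoteA, VoteB} \<and> length xs = a + b}"
    by (rule finite_lists_length_eq) simp
qed

lemma ballots_nonempty: "ballots a b \<noteq> {}"
proof -
  have "count_list (replicate n x) y = (if x = y then n else 0)" for n and x y :: vote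
    by (induction n) auto
  then have "replicate a VoteA @ replicate b VoteB \<in> ballots a b"
    by (simp add: ballots_def)
  then show ?thesis by blast
qed

end

theory Submission
  imports Defs "HOL-Combinatorics.Multiset_Permutations"
begin

text \<open>
  Lower bound: count a vote for \<open>A\<close> as \<open>1\<close> and a vote for \<open>B\<close> as \<open>- \<mu>\<close>, and let \<open>f\<close> be the partial
  sums of the periodic extension of a ballot sequence. The rotation starting at \<open>i\<close> is cute if \<open>f\<close>
  never drops below \<open>f i\<close> after \<open>i\<close>. The infimum of \<open>f\<close> over \<open>{i..}\<close> grows by \<open>a - \<mu> b\<close> per
  period; it grows only at such \<open>i\<close>, and by at most \<open>1\<close> each time, so at least \<open>a - \<mu> b\<close> of the
  rotations are cute. This is a strict inequality if \<open>b > 0\<close>: replacing \<open>\<mu>\<close> by a slightly smaller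
  number makes no further rotation cute, but increases \<open>a - \<mu> b\<close>. Averaging over all ballot
  sequences gives the bound.

  Upper bound: \<open>(a + 1 - \<mu> b) / (a + 1)\<close> times the number of ballot sequences equals
  \<open>(a + b choose a) - \<mu> (a + b choose (a + 1))\<close>. This satisfies Pascal's recurrence and is
  nonnegative for \<open>\<mu> b \<le> a + 1\<close>, so by induction it dominates the number of cute sequences, to
  which Pascal's recurrence applies as an inequality and which vanishes for \<open>a < \<mu> b\<close>.
\<close>

section \<open>Cycle lemma and double counting\<close>

lemma bdd_below_quasiperiodic:
  fixes f :: "nat \<Rightarrow> real"
  assumes shift: "\<And>i. f (i + n) = f i + d" and "0 \<le> d" and "0 < n"
  shows "bdd_below (range f)"
proof -
  have "Min (f ` {..<n}) \<le> f j" for j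
  proof (induction j rule: less_induct)
    case (less j)
    show ?case
    proof (cases "j < n")
      case False
      then have "Min (f ` {..<n}) \<le> f (j - n)"
        using \<open>0 < n\<close> by (intro less.IH) simp
      also have "\<dots> \<le> f j"
        using shift[of "j - n"] False \<open>0 \<le> d\<close> by simp
      finally show ?thesis .
    qed simp
  qed
  then show ?thesis by (rule bdd_belowI2)
qed

lemma Inf_tail_increment_le:
  fixes f :: "nat \<Rightarrow> real"
  assumes "bdd_below (range f)" and step: "f (Suc i) \<le> f i + 1"
  shows "Inf (f ` {Suc i..}) - Inf (f ` {i..}) \<le> of_bool (\<forall>j\<ge>i. f i \<le> f j)"
proof -
  have bdd: "bdd_below (f ` {k..})" for k
    using assms(1) by (rule bdd_below_mono) blast
  then have lower: "Inf (f ` {k..}) \<le> f j" if "k \<le> j" for k j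
    using that by (intro cInf_lower) auto
  show ?thesis
  proof (cases "\<forall>j\<ge>i. f i \<le> f j")
    case True
    then have "f i \<le> Inf (f ` {i..})"
      by (intro cInf_greatest) auto
    then show ?thesis
      using True lower[of "Suc i" "Suc i"] step by simp
  next
    case False
    then obtain j where "i \<le> j" "f j < f i" by force
    then have "Inf (f ` {Suc i..}) < f i"
      using lower[of "Suc i" j] by (cases "i = j") auto
    moreover have "{i..} = insert i {Suc i..}" by auto
    ultimately have "Inf (f ` {i..}) = Inf (f ` {Suc i..})"
      by (simp add: cInf_insert[OF _ bdd] inf_min)
    with False show ?thesis by simp
  qed
qed

lemma cycle_lemma:
  fixes f :: "nat \<Rightarrow> real"
  assumes shift: "\<And>i. f (i + n) = f i + d"
    and step: "\<And>i. f (Suc i) \<le> f i + 1"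
  shows "d \<le> real (card {i. i < n \<and> (\<forall>j\<ge>i. f i \<le> f j)})"
proof (cases "0 < d")
  case True
  with shift[of 0] have "0 < n" by (intro gr0I) simp
  then have bdd: "bdd_below (range f)"
    using True by (intro bdd_below_quasiperiodic[of f n d] shift) simp_all
  define m where "m i = Inf (f ` {i..})" for i
  have "m 0 + d \<le> f j" if "n \<le> j" for j
  proof -
    have "m 0 \<le> f (j - n)"
      unfolding m_def using bdd by (intro cInf_lower) auto
    then show ?thesis using shift[of "j - n"] that by simp
  qed
  then have "m 0 + d \<le> m n"
    unfolding m_def[of n] by (intro cInf_greatest) auto
  then have "d \<le> (\<Sum>i<n. m (Suc i) - m i)"
    by (simp add: sum_lessThan_telescope)
  also have "\<dots> \<le> (\<Sum>i<n. of_bool (\<forall>j\<ge>i. f i \<le> f j))"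
    unfolding m_def by (intro sum_mono Inf_tail_increment_le bdd step)
  also have "\<dots> = real (card {i. i < n \<and> (\<forall>j\<ge>i. f i \<le> f j)})"
    by (simp add: Int_def)
  finally show ?thesis .
next
  case False
  then have "d \<le> 0" by simp
  also have "0 \<le> real (card {i. i < n \<and> (\<forall>j\<ge>i. f i \<le> f j)})" by simp
  finally show ?thesis .
qed

lemma sum_card_bij_betw:
  assumes "finite I" and "finite S" and bij: "\<And>i. i \<in> I \<Longrightarrow> bij_betw (f i) S S"
  shows "(\<Sum>x\<in>S. card {i \<in> I. P (f i x)}) = card I * card {x \<in> S. P x}"
proof -
  have "card {x \<in> S. P (f i x)} = card {x \<in> S. P x}" if "i \<in> I" for i
    using bij_betw_Collect[OF bij[OF that]] by (rule bij_betw_same_card) simp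
  then have "(\<Sum>x\<in>S. card {i \<in> I. P (f i x)}) = (\<Sum>i\<in>I. card {x \<in> S. P x})"
    using assms by (intro sum_multicount_gen) auto
  then show ?thesis by simp
qed

section \<open>Ballots as permutations of a multiset\<close>

lemma ballots_eq_permutations_of_multiset:
  "ballots a b = permutations_of_multiset (replicate_mset a VoteA + replicate_mset b VoteB)"
proof -
  have "mset xs = replicate_mset a VoteA + replicate_mset b VoteB \<longleftrightarrow>
      count_list xs VoteA = a \<and> count_list xs VoteB = b" for xs
  proof -
    have "(\<forall>v. P v) \<longleftrightarrow> P VoteA \<and> P VoteB" for P
      by (metis vote.exhaust)
    then show ?thesis by (simp add: multiset_eq_iff count_mset)
  qed
  then show ?thesis by (simp add: ballots_def permutations_of_multiset_def)
qed

lemma card_ballots: "card (ballots a b) = (a + b) choose a"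
proof -
  let ?M = "replicate_mset a VoteA + replicate_mset b VoteB"
  have "(\<Prod>v\<in>set_mset ?M. fact (count ?M v)) = (\<Prod>v\<in>{VoteA, VoteB}. fact (count ?M v) :: nat)"
    by (rule prod.mono_neutral_left) (auto split: if_splits)
  then have "card (ballots a b) = fact (a + b) div (fact a * fact b)"
    by (simp add: ballots_eq_permutations_of_multiset card_permutations_of_multiset(1))
  then show ?thesis by (simp add: binomial_fact')
qed

lemma mset_rotate: "mset (rotate i xs) = mset xs"
  by (metis append_take_drop_id mset_append rotate_drop_take union_commute)

lemma bij_betw_rotate_permutations_of_multiset:
  "bij_betw (rotate i) (permutations_of_multiset M) (permutations_of_multiset M)"
proof -
  have "inj_on (rotate i) (permutations_of_multiset M)"
    using inj_fn[OF inj_rotate1, of i] unfolding rotate_def by (rule inj_on_subset) simp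
  moreover have "rotate i ` permutations_of_multiset M \<subseteq> permutations_of_multiset M"
    by (auto simp: permutations_of_multiset_def mset_rotate)
  ultimately show ?thesis
    using endo_inj_surj[OF finite_permutations_of_multiset] by (simp add: bij_betw_def)
qed

lemma cute_prob_eq:
  "cute_prob \<mu> a b = real (card {xs \<in> ballots a b. cute \<mu> xs}) / real ((a + b) choose a)"
  by (simp add: cute_prob_def measure_pmf_of_set[OF ballots_nonempty finite_ballots]
      Int_def card_ballots)

section \<open>Margins of vote sequences\<close>

definition margin :: "real \<Rightarrow> vote list \<Rightarrow> real" where
  "margin \<mu> xs = real (count_list xs VoteA) - \<mu> * real (count_list xs VoteB)"

lemma margin_append: "margin \<mu> (xs @ ys) = margin \<mu> xs + margin \<mu> ys"
  by (simp add: margin_def algebra_simps)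

lemma margin_singleton_le_1: "0 \<le> \<mu> \<Longrightarrow> margin \<mu> [v] \<le> 1"
  by (cases v) (simp_all add: margin_def)

lemma margin_rotate: "margin \<mu> (rotate i xs) = margin \<mu> xs"
  by (simp add: margin_def mset_rotate flip: count_mset)

lemma margin_ballots: "xs \<in> ballots a b \<Longrightarrow> margin \<mu> xs = real a - \<mu> * real b"
  by (simp add: margin_def ballots_def)

lemma cute_iff_margin: "cute \<mu> xs \<longleftrightarrow> (\<forall>r\<le>length xs. 0 \<le> margin \<mu> (take r xs))"
proof -
  have "0 \<le> margin \<mu> (take 0 xs)" by (simp add: margin_def)
  then have "(\<forall>r\<le>length xs. 0 \<le> margin \<mu> (take r xs)) \<longleftrightarrow>
      (\<forall>r\<in>{1..length xs}. 0 \<le> margin \<mu> (take r xs))"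
    by (metis One_nat_def Suc_leI atLeastAtMost_iff gr0I)
  then show ?thesis by (simp add: cute_def margin_def)
qed

lemma cute_appendD:
  assumes "cute \<mu> (xs @ ys)"
  shows "cute \<mu> xs"
proof -
  have "0 \<le> margin \<mu> (take r xs)" if "r \<le> length xs" for r
    using assms that by (auto simp: cute_iff_margin dest!: spec[of _ r])
  then show ?thesis by (simp add: cute_iff_margin)
qed

lemma closed_Collect_cute: "closed {\<mu>. cute \<mu> xs}"
  unfolding cute_iff_margin margin_def
  by (intro closed_Collect_all closed_Collect_imp open_Collect_const closed_Collect_le
      continuous_intros)

lemma eventually_cute_imp_cute: "\<forall>\<^sub>F \<nu> in at \<mu> within S. cute \<nu> xs \<longrightarrow> cute \<mu> xs"
proof (cases "cute \<mu> xs")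
  case False
  then have "\<forall>\<^sub>F \<nu> in at \<mu> within S. \<nu> \<in> - {\<nu>. cute \<nu> xs}"
    using closed_Collect_cute by (intro topological_tendstoD[OF tendsto_ident_at]) auto
  then show ?thesis by (rule eventually_mono) simp
qed simp

section \<open>The lower bound\<close>

lemma take_rotate_conv_map_upt:
  assumes "r \<le> length xs"
  shows "take r (rotate i xs) = map (\<lambda>l. xs ! (l mod length xs)) [i..<i + r]"
  using assms by (intro nth_equalityI) (simp_all add: nth_rotate)

lemma margin_le_card_cute_rotations:
  assumes "0 \<le> \<mu>"
  shows "margin \<mu> xs \<le> real (card {i. i < length xs \<and> cute \<mu> (rotate i xs)})"
proof -
  define f where "f j = margin \<mu> (map (\<lambda>l. xs ! (l mod length xs)) [0..<j])" for j
  have f_add: "f (i + r) = f i + margin \<mu> (take r (rotate i xs))" if "r \<le> length xs" for i r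
    by (simp add: f_def take_rotate_conv_map_upt[OF that] upt_add_eq_append[of 0 i r] margin_append)
  have "margin \<mu> xs \<le> real (card {i. i < length xs \<and> (\<forall>j\<ge>i. f i \<le> f j)})"
  proof (rule cycle_lemma)
    show "f (i + length xs) = f i + margin \<mu> xs" for i
      by (simp add: f_add margin_rotate)
    show "f (Suc i) \<le> f i + 1" for i
      by (simp add: f_def margin_append margin_singleton_le_1 assms)
  qed
  also have "\<dots> \<le> real (card {i. i < length xs \<and> cute \<mu> (rotate i xs)})"
  proof (intro of_nat_mono card_mono Collect_mono conj_mono impI)
    fix i assume tail_ge: "\<forall>j\<ge>i. f i \<le> f j"
    show "cute \<mu> (rotate i xs)"
      unfolding cute_iff_margin
    proof (intro allI impI)
      fix r assume "r \<le> length (rotate i xs)"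
      then show "0 \<le> margin \<mu> (take r (rotate i xs))"
        using tail_ge f_add[of r i] le_add1[of i r] by fastforce
    qed
  qed simp_all
  finally show ?thesis .
qed

lemma margin_less_card_cute_rotations:
  assumes "0 < \<mu>" and "VoteB \<in> set xs"
  shows "margin \<mu> xs < real (card {i. i < length xs \<and> cute \<mu> (rotate i xs)})"
proof -
  have "\<forall>\<^sub>F \<nu> in at_left \<mu>. \<forall>i\<in>{..<length xs}. cute \<nu> (rotate i xs) \<longrightarrow> cute \<mu> (rotate i xs)"
    by (intro eventually_ball_finite ballI eventually_cute_imp_cute) simp
  moreover have "\<forall>\<^sub>F \<nu> in at_left \<mu>. \<nu> \<in> {0<..<\<mu>}"
    using \<open>0 < \<mu>\<close> by (rule eventually_at_left_real)
  ultimately have "\<exists>\<nu>. (\<forall>i\<in>{..<length xs}. cute \<nu> (rotate i xs) \<longrightarrow> cute \<mu> (rotate i xs)) \<and>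
      \<nu> \<in> {0<..<\<mu>}"
    by (intro eventually_happens'[OF trivial_limit_at_left_real] eventually_conj)
  then obtain \<nu> where \<nu>: "0 < \<nu>" "\<nu> < \<mu>"
    and cute_imp: "\<And>i. i < length xs \<Longrightarrow> cute \<nu> (rotate i xs) \<Longrightarrow> cute \<mu> (rotate i xs)"
    by auto
  have "0 < count_list xs VoteB"
    using \<open>VoteB \<in> set xs\<close> count_list_0_iff by force
  then have "margin \<mu> xs < margin \<nu> xs"
    using \<nu> by (simp add: margin_def)
  also have "\<dots> \<le> real (card {i. i < length xs \<and> cute \<nu> (rotate i xs)})"
    using \<nu> by (intro margin_le_card_cute_rotations) simp
  also have "\<dots> \<le> real (card {i. i < length xs \<and> cute \<mu> (rotate i xs)})"
    by (intro of_nat_mono card_mono) (auto intro: cute_imp)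
  finally show ?thesis .
qed

lemma sum_card_cute_rotations:
  "(\<Sum>xs\<in>ballots a b. card {i. i < a + b \<and> cute \<mu> (rotate i xs)})
    = (a + b) * card {xs \<in> ballots a b. cute \<mu> xs}"
proof -
  have "(\<Sum>xs\<in>ballots a b. card {i \<in> {..<a + b}. cute \<mu> (rotate i xs)})
      = card {..<a + b} * card {xs \<in> ballots a b. cute \<mu> xs}"
    unfolding ballots_eq_permutations_of_multiset
    by (rule sum_card_bij_betw) (simp_all add: bij_betw_rotate_permutations_of_multiset)
  then show ?thesis by simp
qed

lemma floor_le_cute_prob:
  assumes "1 \<le> b" and "0 < \<mu>"
  shows "real_of_int \<lfloor>real a - \<mu> * real b + 1\<rfloor> / real (a + b) \<le> cute_prob \<mu> a b"
proof -
  let ?k = "\<lfloor>real a - \<mu> * real b + 1\<rfloor>"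
  let ?rotations = "\<lambda>xs. {i. i < a + b \<and> cute \<mu> (rotate i xs)}"
  have floor_le_card: "?k \<le> int (card (?rotations xs))" if xs: "xs \<in> ballots a b" for xs
  proof -
    have "VoteB \<in> set xs"
      using xs \<open>1 \<le> b\<close> count_list_0_iff[of xs VoteB] by (auto simp: ballots_def)
    then have "real a - \<mu> * real b < real (card (?rotations xs))"
      using margin_less_card_cute_rotations[OF \<open>0 < \<mu>\<close>] margin_ballots[OF xs] length_ballots[OF xs]
      by fastforce
    then show ?thesis by (simp only: floor_le_iff)
  qed
  have "int ((a + b) choose a) * ?k \<le> (\<Sum>xs\<in>ballots a b. int (card (?rotations xs)))"
    unfolding card_ballots[symmetric] by (rule sum_bounded_below) (rule floor_le_card)
  also have "\<dots> = int ((a + b) * card {xs \<in> ballots a b. cute \<mu> xs})"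
    by (simp only: sum_card_cute_rotations flip: of_nat_sum)
  finally have "real ((a + b) choose a) * ?k \<le> real (a + b) * card {xs \<in> ballots a b. cute \<mu> xs}"
    by (simp flip: of_int_le_iff[where 'a = real])
  moreover have "0 < real ((a + b) choose a)" by simp
  ultimately show ?thesis
    using \<open>1 \<le> b\<close> by (simp add: cute_prob_eq field_simps)
qed

section \<open>The upper bound\<close>

lemma card_cute_Suc_Suc_le:
  "card {xs \<in> ballots (Suc a) (Suc b). cute \<mu> xs}
    \<le> card {xs \<in> ballots a (Suc b). cute \<mu> xs} + card {xs \<in> ballots (Suc a) b. cute \<mu> xs}"
    (is "card ?C \<le> card ?A + card ?B")
proof -
  have "xs \<in> (\<lambda>ys. ys @ [VoteA]) ` ?A \<union> (\<lambda>ys. ys @ [VoteB]) ` ?B" if "xs \<in> ?C" for xs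
  proof (cases xs rule: rev_cases)
    case (snoc ys v)
    with that show ?thesis
      by (cases v) (auto simp: ballots_def dest: cute_appendD)
  qed (use that in \<open>simp add: ballots_def\<close>)
  then have "card ?C \<le> card ((\<lambda>ys. ys @ [VoteA]) ` ?A \<union> (\<lambda>ys. ys @ [VoteB]) ` ?B)"
    by (intro card_mono subsetI) (simp_all add: finite_ballots)
  also have "\<dots> \<le> card ((\<lambda>ys. ys @ [VoteA]) ` ?A) + card ((\<lambda>ys. ys @ [VoteB]) ` ?B)"
    by (rule card_Un_le)
  also have "\<dots> \<le> card ?A + card ?B"
    by (intro add_mono card_image_le) (simp_all add: finite_ballots)
  finally show ?thesis .
qed

lemma no_cute_ballots:
  assumes "real a < \<mu> * real b"
  shows "{xs \<in> ballots a b. cute \<mu> xs} = {}"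
proof -
  have "0 \<le> margin \<mu> xs" if "cute \<mu> xs" for xs
    using that unfolding cute_iff_margin by (metis order_refl take_all)
  then show ?thesis using assms margin_ballots by fastforce
qed

lemma binomial_diff_eq:
  "real ((a + b) choose a) - \<mu> * real ((a + b) choose Suc a)
    = (real a + 1 - \<mu> * real b) / (real a + 1) * real ((a + b) choose a)"
proof -
  have "Suc a * ((a + b) choose Suc a) = b * ((a + b) choose a)"
    using binomial_absorption[of a "a + b"] binomial_absorb_comp[of "a + b" a] by simp
  then have "(real a + 1) * real ((a + b) choose Suc a) = real b * real ((a + b) choose a)"
    by (metis of_nat_Suc of_nat_mult add.commute)
  then show ?thesis by (simp add: field_simps)
qed

lemma card_cute_le_binomial_diff:
  assumes "0 \<le> \<mu>" and "\<mu> * real b \<le> real a + 1"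
  shows "real (card {xs \<in> ballots a b. cute \<mu> xs})
    \<le> real ((a + b) choose a) - \<mu> * real ((a + b) choose Suc a)"
  using assms(2)
proof (induction "a + b" arbitrary: a b rule: less_induct)
  case less
  have "0 \<le> \<mu> * real b" using \<open>0 \<le> \<mu>\<close> by simp
  then consider (zero) "\<mu> * real b = 0" | (deficit) "real a < \<mu> * real b"
    | (surplus) "0 < \<mu> * real b" "\<mu> * real b \<le> real a"
    by linarith
  then show ?case
  proof cases
    case zero
    have "card {xs \<in> ballots a b. cute \<mu> xs} \<le> card (ballots a b)"
      by (intro card_mono finite_ballots) blast
    then show ?thesis unfolding binomial_diff_eq zero by (simp add: card_ballots)
  next
    case deficit
    then show ?thesis
      using less.prems by (simp add: no_cute_ballots binomial_diff_eq)
  next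
    case surplus
    then have "a \<noteq> 0" "b \<noteq> 0"
      by (intro notI; simp)+
    then obtain a' b' where a: "a = Suc a'" and b: "b = Suc b'"
      using not0_implies_Suc by metis
    have last_A: "real (card {xs \<in> ballots a' b. cute \<mu> xs})
        \<le> real ((a' + b) choose a') - \<mu> * real ((a' + b) choose Suc a')"
      using surplus a by (intro less.hyps) simp_all
    have last_B: "real (card {xs \<in> ballots a b'. cute \<mu> xs})
        \<le> real ((a + b') choose a) - \<mu> * real ((a + b') choose Suc a)"
      using surplus b \<open>0 \<le> \<mu>\<close> by (intro less.hyps) (simp_all add: algebra_simps)
    have "real (card {xs \<in> ballots a b. cute \<mu> xs})
        \<le> real (card {xs \<in> ballots a' b. cute \<mu> xs}) + real (card {xs \<in> ballots a b'. cute \<mu> xs})"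
      using card_cute_Suc_Suc_le[of a' b' \<mu>] by (simp add: a b flip: of_nat_add)
    with last_A last_B show ?thesis unfolding a b by (simp add: algebra_simps)
  qed
qed

lemma cute_prob_le:
  assumes "0 \<le> \<mu>" and "\<mu> * real b \<le> real a + 1"
  shows "cute_prob \<mu> a b \<le> (real a + 1 - \<mu> * real b) / (real a + 1)"
proof -
  have "0 < real ((a + b) choose a)" by simp
  then show ?thesis
    using card_cute_le_binomial_diff[OF assms] unfolding cute_prob_eq binomial_diff_eq
    by (simp add: pos_divide_le_eq)
qed

theorem theorem2:
  fixes a b :: nat and \<mu> :: real
  assumes "a + b \<ge> 1" and "\<mu> > 0" and "real a \<ge> \<mu> * real b"
  shows "(b \<ge> 1 \<longrightarrow> real_of_int \<lfloor>real a - \<mu> * real b + 1\<rfloor> / real (a + b) \<le> cute_prob \<mu> a b)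
    \<and> cute_prob \<mu> a b \<le> (real a + 1 - \<mu> * real b) / (real a + 1)"
proof (intro conjI impI)
  show "real_of_int \<lfloor>real a - \<mu> * real b + 1\<rfloor> / real (a + b) \<le> cute_prob \<mu> a b" if "b \<ge> 1"
    using that \<open>\<mu> > 0\<close> by (rule floor_le_cute_prob)
  show "cute_prob \<mu> a b \<le> (real a + 1 - \<mu> * real b) / (real a + 1)"
    using assms by (intro cute_prob_le) simp_all
qed

end
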